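(* Let $(G,\cdot)$ be a group with identity element $e$ and let $\mathcal{A}: G\rightarrow G$ be an averaging operator on $G$. Define $g\diamond_{\mathcal{A}} h := \mathcal{A}(g) h\mathcal{A}(g)^{-1}$ for $g,h\in G$. Then $(G,\cdot,\diamond_{\mathcal{A}})$ is a group-rack. Further, if $\mathcal{A}$ is a pointed averaging operator, then $(G,\cdot,\diamond_{\mathcal{A}})$ is a pointed group-rack.
   Context: An averaging operator on a group $G$ is a map $\mathcal{A}:G\to G$ with $\mathcal{A}(g)\mathcal{A}(h)\mathcal{A}(g)^{-1} = \mathcal{A}(\mathcal{A}(g)h\mathcal{A}(g)^{-1})$ for all $g,h\in G$; it is pointed if $\mathcal{A}(e)=e$. A (left) rack $(Q,\diamond)$ is a nonempty set $Q$ with a binary operation $\diamond$ such that $x\diamond(y\diamond z) = (x\diamond y)\diamond(x\diamond z)$ for all $x,y,z$, and for any $x,y$ there is a unique $c$ with $x\diamond c = y$. A rack is pointed with distinguished element $e$ if $x\diamond e=e$ and $e\diamond x = x$ for all $x$. A group-rack is a triple $(G,\cdot,\star)$ in which $(G,\cdot)$ is a group, $(G,\star)$ is a rack, and $x\star(yz) = (x\star y)(x\star z)$ for all $x,y,z\in G$. A group-rack is pointed if the rack $(G,\star)$ is pointed with distinguished element the identity element $e$ of the group. *)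

theory Defs
  imports "HOL-Algebra.Group"
begin

definition averaging_operator :: "('a, 'm) monoid_scheme \<Rightarrow> ('a \<Rightarrow> 'a) \<Rightarrow> bool" where
  "averaging_operator G A \<longleftrightarrow>
     A \<in> carrier G \<rightarrow> carrier G \<and>
     (\<forall>g \<in> carrier G. \<forall>h \<in> carrier G.
        A g \<otimes>\<^bsub>G\<^esub> A h \<otimes>\<^bsub>G\<^esub> inv\<^bsub>G\<^esub> (A g) = A (A g \<otimes>\<^bsub>G\<^esub> h \<otimes>\<^bsub>G\<^esub> inv\<^bsub>G\<^esub> (A g)))"

definition pointed_averaging_operator :: "('a, 'm) monoid_scheme \<Rightarrow> ('a \<Rightarrow> 'a) \<Rightarrow> bool" where
  "pointed_averaging_operator G A \<longleftrightarrow> averaging_operator G A \<and> A \<one>\<^bsub>G\<^esub> = \<one>\<^bsub>G\<^esub>"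

definition rack :: "'a set \<Rightarrow> ('a \<Rightarrow> 'a \<Rightarrow> 'a) \<Rightarrow> bool" where
  "rack Q op \<longleftrightarrow>
     Q \<noteq> {} \<and>
     op \<in> Q \<rightarrow> Q \<rightarrow> Q \<and>
     (\<forall>x \<in> Q. \<forall>y \<in> Q. \<forall>z \<in> Q. op x (op y z) = op (op x y) (op x z)) \<and>
     (\<forall>x \<in> Q. \<forall>y \<in> Q. \<exists>!c. c \<in> Q \<and> op x c = y)"

definition pointed_rack :: "'a set \<Rightarrow> ('a \<Rightarrow> 'a \<Rightarrow> 'a) \<Rightarrow> 'a \<Rightarrow> bool" where
  "pointed_rack Q op e \<longleftrightarrow>
     rack Q op \<and> e \<in> Q \<and> (\<forall>x \<in> Q. op x e = e \<and> op e x = x)"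

definition group_rack :: "('a, 'm) monoid_scheme \<Rightarrow> ('a \<Rightarrow> 'a \<Rightarrow> 'a) \<Rightarrow> bool" where
  "group_rack G op \<longleftrightarrow>
     group G \<and> rack (carrier G) op \<and>
     (\<forall>x \<in> carrier G. \<forall>y \<in> carrier G. \<forall>z \<in> carrier G.
        op x (y \<otimes>\<^bsub>G\<^esub> z) = op x y \<otimes>\<^bsub>G\<^esub> op x z)"

definition pointed_group_rack :: "('a, 'm) monoid_scheme \<Rightarrow> ('a \<Rightarrow> 'a \<Rightarrow> 'a) \<Rightarrow> bool" where
  "pointed_group_rack G op \<longleftrightarrow> group_rack G op \<and> pointed_rack (carrier G) op \<one>\<^bsub>G\<^esub>"

definition averaging_rack_op ::
    "('a, 'm) monoid_scheme \<Rightarrow> ('a \<Rightarrow> 'a) \<Rightarrow> 'a \<Rightarrow> 'a \<Rightarrow> 'a" where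
  "averaging_rack_op G A g h = A g \<otimes>\<^bsub>G\<^esub> h \<otimes>\<^bsub>G\<^esub> inv\<^bsub>G\<^esub> (A g)"

end

theory Submission
  imports Defs
begin

text \<open>Left multiplication by \<open>x\<close> in \<open>averaging_rack_op\<close> is
  conjugation by \<open>A x\<close>, an inner automorphism. Hence it is a multiplicative bijection
  of the carrier (\<open>conjugate_mult_distrib\<close>, \<open>conjugate_eq_iff\<close>). The
  averaging identity says that \<open>A\<close> sends the conjugate of \<open>y\<close> by
  \<open>A x\<close> to the conjugate of \<open>A y\<close> by \<open>A x\<close>; this is exactly
  what self-distributivity requires. In the pointed case \<open>A\<close> fixes the unit, so the
  unit acts trivially.\<close>

context group
begin

lemma conjugate_mult_distrib:
  assumes "a \<in> carrier G" "x \<in> carrier G" "y \<in> carrier G"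
  shows "a \<otimes> (x \<otimes> y) \<otimes> inv a = (a \<otimes> x \<otimes> inv a) \<otimes> (a \<otimes> y \<otimes> inv a)"
proof -
  \<comment> \<open>The cancellation in the middle, stated in the right-nested form that
    \<open>m_assoc\<close> produces.\<close>
  have "inv a \<otimes> (a \<otimes> (y \<otimes> inv a)) = y \<otimes> inv a"
    using assms by (simp add: m_assoc [symmetric])
  then show ?thesis
    using assms by (simp add: m_assoc)
qed

lemma conjugate_inv:
  assumes "a \<in> carrier G" "x \<in> carrier G"
  shows "inv (a \<otimes> x \<otimes> inv a) = a \<otimes> inv x \<otimes> inv a"
  using assms by (simp add: inv_mult_group m_assoc)

text \<open>Conjugation by \<open>inv a\<close> undoes conjugation by \<open>a\<close>; this yields
  both existence and uniqueness in left division.\<close>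

lemma conjugate_eq_iff:
  assumes "a \<in> carrier G" "x \<in> carrier G" "y \<in> carrier G"
  shows "a \<otimes> x \<otimes> inv a = y \<longleftrightarrow> x = inv a \<otimes> y \<otimes> a"
proof -
  have "inv a \<otimes> (a \<otimes> u) = u" "a \<otimes> (inv a \<otimes> u) = u" if "u \<in> carrier G" for u
    using assms that by (simp_all add: m_assoc [symmetric])
  then show ?thesis
    using assms by (auto simp: m_assoc)
qed

lemma rack_averaging_rack_op:
  assumes "averaging_operator G A"
  shows "rack (carrier G) (averaging_rack_op G A)"
proof -
  have A [simp]: "A g \<in> carrier G" if "g \<in> carrier G" for g
    using assms that by (auto simp: averaging_operator_def)
  have avg: "A (A g \<otimes> h \<otimes> inv (A g)) = A g \<otimes> A h \<otimes> inv (A g)"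
    if "g \<in> carrier G" "h \<in> carrier G" for g h
    using assms that by (simp add: averaging_operator_def)
  show ?thesis
    unfolding rack_def averaging_rack_op_def
  proof (intro conjI ballI)
    fix x y z
    assume "x \<in> carrier G" "y \<in> carrier G" "z \<in> carrier G"
    then show "A x \<otimes> (A y \<otimes> z \<otimes> inv (A y)) \<otimes> inv (A x) =
      A (A x \<otimes> y \<otimes> inv (A x)) \<otimes> (A x \<otimes> z \<otimes> inv (A x)) \<otimes> inv (A (A x \<otimes> y \<otimes> inv (A x)))"
      \<comment> \<open>Both sides become the product of the conjugates by \<open>A x\<close> of
        \<open>A y\<close>, \<open>z\<close> and \<open>inv (A y)\<close>: the left by
        multiplicativity, the right by \<open>avg\<close> and \<open>conjugate_inv\<close>.\<close>
      by (simp add: avg conjugate_inv conjugate_mult_distrib)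
  next
    fix x y
    assume "x \<in> carrier G" "y \<in> carrier G"
    then show "\<exists>!c. c \<in> carrier G \<and> A x \<otimes> c \<otimes> inv (A x) = y"
      \<comment> \<open>\<open>conj_cong\<close> supplies \<open>c \<in> carrier G\<close> while the
        equation is solved as \<open>c = inv (A x) \<otimes> y \<otimes> A x\<close>.\<close>
      by (auto simp: conjugate_eq_iff cong: conj_cong)
  qed auto
qed

end

theorem proposition2p19:
  fixes G :: "('a, 'm) monoid_scheme" and A :: "'a \<Rightarrow> 'a"
  assumes "group G"
    and "averaging_operator G A"
  shows "group_rack G (averaging_rack_op G A) \<and>
    (pointed_averaging_operator G A \<longrightarrow> pointed_group_rack G (averaging_rack_op G A))"
proof -
  interpret group G by fact
  have A: "A g \<in> carrier G" if "g \<in> carrier G" for g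
    using assms(2) that by (auto simp: averaging_operator_def)
  have rack: "rack (carrier G) (averaging_rack_op G A)"
    using assms(2) by (rule rack_averaging_rack_op)
  then have "group_rack G (averaging_rack_op G A)"
    using A by (simp add: group_rack_def averaging_rack_op_def conjugate_mult_distrib
        is_group)
  \<comment> \<open>Every conjugation fixes the unit; \<open>A \<one> = \<one>\<close> makes the
    unit act as the identity.\<close>
  moreover have "pointed_rack (carrier G) (averaging_rack_op G A) \<one>\<^bsub>G\<^esub>"
    if "pointed_averaging_operator G A"
    using that A rack
    by (simp add: pointed_rack_def pointed_averaging_operator_def averaging_rack_op_def)
  ultimately show ?thesis
    by (simp add: pointed_group_rack_def)
qed

end
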